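(* Let $n\ge 2$ and $d\ge 2$ be integers, and let $G$ be a graph on $n$ vertices with no isolated vertex such that the maximum degree of the complement $\overline{G}$ equals $d-1$. Then $$\mathrm{scc}(G)\le (e^2+1)\,n\,d\left\lceil \ln\left(\frac{n-1}{d-1}\right)\right\rceil.$$
   Context: All graphs are finite, simple and undirected; $\overline{G}$ denotes the complement of $G$. A clique of $G$ is a set of pairwise adjacent vertices, and a clique covering of $G$ is a family of cliques such that every edge of $G$ lies in at least one of them. $\mathrm{scc}(G)$ is the minimum of $\sum_{C\in\mathcal{C}}|C|$ over all clique coverings $\mathcal{C}$ of $G$. *)

theory Defs
  imports Complex_Main
begin

definition all_pairs :: "'a set \<Rightarrow> 'a set set" where
  "all_pairs V = {{u, v} | u v. u \<in> V \<and> v \<in> V \<and> u \<noteq> v}"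

definition simple_graph :: "'a set \<Rightarrow> 'a set set \<Rightarrow> bool" where
  "simple_graph V E \<longleftrightarrow> finite V \<and> E \<subseteq> all_pairs V"

definition complement_edges :: "'a set \<Rightarrow> 'a set set \<Rightarrow> 'a set set" where
  "complement_edges V E = all_pairs V - E"

definition vertex_degree :: "'a set \<Rightarrow> 'a set set \<Rightarrow> 'a \<Rightarrow> nat" where
  "vertex_degree V E v = card {u \<in> V. {v, u} \<in> E}"

definition max_degree :: "'a set \<Rightarrow> 'a set set \<Rightarrow> nat" where
  "max_degree V E = Max (vertex_degree V E ` V)"

definition isolated :: "'a set \<Rightarrow> 'a set set \<Rightarrow> 'a \<Rightarrow> bool" where
  "isolated V E v \<longleftrightarrow> v \<in> V \<and> (\<forall>u\<in>V. {v, u} \<notin> E)"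

definition clique :: "'a set \<Rightarrow> 'a set set \<Rightarrow> 'a set \<Rightarrow> bool" where
  "clique V E C \<longleftrightarrow> C \<subseteq> V \<and> (\<forall>u\<in>C. \<forall>v\<in>C. u \<noteq> v \<longrightarrow> {u, v} \<in> E)"

definition clique_covering :: "'a set \<Rightarrow> 'a set set \<Rightarrow> 'a set set \<Rightarrow> bool" where
  "clique_covering V E \<C> \<longleftrightarrow> (\<forall>C\<in>\<C>. clique V E C) \<and> (\<forall>e\<in>E. \<exists>C\<in>\<C>. e \<subseteq> C)"

text \<open>Families are sets of cliques: repeating a clique only increases the sum, so allowing
  multiplicities would not change the minimum. The minimum is over a finite nonempty set for
  every simple graph, as shown below.\<close>

definition scc :: "'a set \<Rightarrow> 'a set set \<Rightarrow> nat" where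
  "scc V E = Min {\<Sum>C\<in>\<C>. card C | \<C>. clique_covering V E \<C>}"

lemma finite_clique_coverings:
  assumes "simple_graph V E"
  shows "finite {\<C>. clique_covering V E \<C>}"
proof (rule finite_subset)
  show "{\<C>. clique_covering V E \<C>} \<subseteq> Pow (Pow V)"
    by (auto simp: clique_covering_def clique_def)
  show "finite (Pow (Pow V))"
    using assms by (simp add: simple_graph_def)
qed

lemma clique_covering_edges:
  assumes "simple_graph V E"
  shows "clique_covering V E E"
  unfolding clique_covering_def
proof (intro conjI ballI)
  fix e assume e: "e \<in> E"
  then obtain u v where uv: "e = {u, v}" "u \<in> V" "v \<in> V"
    using assms by (auto simp: simple_graph_def all_pairs_def)
  then show "clique V E e"
    using e by (auto simp: clique_def insert_commute)
  show "\<exists>C\<in>E. e \<subseteq> C"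
    using e by blast
qed

lemma scc_attained:
  assumes "simple_graph V E"
  obtains \<C> where "clique_covering V E \<C>" "scc V E = (\<Sum>C\<in>\<C>. card C)"
proof -
  let ?S = "{\<Sum>C\<in>\<C>. card C | \<C>. clique_covering V E \<C>}"
  have "finite ?S"
    using finite_clique_coverings[OF assms] by simp
  moreover have "?S \<noteq> {}"
    using clique_covering_edges[OF assms] by blast
  ultimately have "scc V E \<in> ?S"
    unfolding scc_def by (rule Min_in)
  then show thesis
    using that by blast
qed

lemma scc_le:
  assumes "simple_graph V E" "clique_covering V E \<C>"
  shows "scc V E \<le> (\<Sum>C\<in>\<C>. card C)"
  unfolding scc_def
  using finite_clique_coverings[OF assms(1)] assms(2) by (intro Min_le) auto

end

theory Submission
  imports Defs "HOL-Probability.Product_PMF"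
begin

text \<open>Put every vertex into a random set \<open>S\<close> independently with probability \<open>1/d\<close> and keep the
  clique of those vertices of \<open>S\<close> that are adjacent to all other vertices of \<open>S\<close>. Its expected size
  is at most \<open>n/d\<close>, and it contains the ends of a given edge with probability at least
  \<open>d\<^sup>-\<^sup>2 (1 - 1/d)\<^bsup>2(d-1)\<^esup> \<ge> (e d)\<^sup>-\<^sup>2\<close>. Draw \<open>t = \<lceil>e\<^sup>2 d\<^sup>2 L\<rceil>\<close> such cliques independently, where
  \<open>L = ln ((n-1)/(d-1))\<close>, and add every edge left uncovered as a clique of size 2. The expected
  total size is at most \<open>t n/d + n (n-1) exp (-L)\<close>, and \<open>n (n-1) exp (-L) = n (d-1)\<close>.\<close>

lemma all_pairs_eq: "all_pairs V = {e. e \<subseteq> V \<and> card e = 2}"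
  by (auto simp: all_pairs_def card_2_iff)

lemma simple_graph_imp_finite_edges:
  assumes "simple_graph V E"
  shows "finite E"
proof (rule finite_subset)
  show "E \<subseteq> Pow V"
    using assms by (auto simp: simple_graph_def all_pairs_eq)
  show "finite (Pow V)"
    using assms by (simp add: simple_graph_def)
qed

lemma card_edges_le:
  assumes "simple_graph V E"
  shows "card E \<le> card V choose 2"
proof -
  have "finite V" "E \<subseteq> {e. e \<subseteq> V \<and> card e = 2}"
    using assms by (auto simp: simple_graph_def all_pairs_eq)
  then have "card E \<le> card {e. e \<subseteq> V \<and> card e = 2}"
    by (intro card_mono) simp_all
  then show ?thesis
    using \<open>finite V\<close> by (simp add: n_subsets)
qed

definition neighbours :: "'a set \<Rightarrow> 'a set set \<Rightarrow> 'a \<Rightarrow> 'a set" where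
  "neighbours V E v = {u \<in> V. {v, u} \<in> E}"

lemma vertex_degree_eq_card_neighbours: "vertex_degree V E v = card (neighbours V E v)"
  by (simp add: vertex_degree_def neighbours_def)

lemma neighbours_complement_edges:
  assumes "v \<in> V"
  shows "neighbours V (complement_edges V E) v = V - {v} - neighbours V E v"
  using assms by (auto simp: neighbours_def complement_edges_def all_pairs_def)

lemma vertex_degree_complement_edges:
  assumes "simple_graph V E" "v \<in> V"
  shows "vertex_degree V E v + vertex_degree V (complement_edges V E) v = card V - 1"
proof -
  have "neighbours V E v \<subseteq> V - {v}" "finite (V - {v})"
    using assms by (auto simp: neighbours_def simple_graph_def all_pairs_def)
  then have "card (V - {v} - neighbours V E v) = card (V - {v}) - card (neighbours V E v)"
    and "card (neighbours V E v) \<le> card (V - {v})"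
    by (auto intro: card_Diff_subset card_mono finite_subset)
  then show ?thesis
    using assms(2)
    by (simp add: vertex_degree_eq_card_neighbours neighbours_complement_edges)
qed

lemma vertex_degree_le_max_degree: "finite V \<Longrightarrow> v \<in> V \<Longrightarrow> vertex_degree V E v \<le> max_degree V E"
  by (simp add: max_degree_def)

lemma vertex_degree_pos:
  assumes "simple_graph V E" "v \<in> V" "\<not> isolated V E v"
  shows "0 < vertex_degree V E v"
  using assms
  by (auto simp: isolated_def vertex_degree_def card_gt_0_iff simple_graph_def)

lemma max_degree_complement_edges_less:
  assumes "simple_graph V E" "V \<noteq> {}" "\<And>v. \<not> isolated V E v"
  shows "max_degree V (complement_edges V E) < card V - 1"
proof -
  have "finite V"
    using assms(1) by (simp add: simple_graph_def)
  moreover have "vertex_degree V (complement_edges V E) v < card V - 1" if "v \<in> V" for v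
    using vertex_degree_pos[OF assms(1) that assms(3)]
      vertex_degree_complement_edges[OF assms(1) that]
    by linarith
  ultimately show ?thesis
    using assms(2) by (simp add: max_degree_def)
qed

definition universal_vertices :: "'a set set \<Rightarrow> 'a set \<Rightarrow> 'a set" where
  "universal_vertices E S = {v \<in> S. \<forall>u\<in>S. u \<noteq> v \<longrightarrow> {v, u} \<in> E}"

lemma clique_universal_vertices: "S \<subseteq> V \<Longrightarrow> clique V E (universal_vertices E S)"
  by (auto simp: clique_def universal_vertices_def)

lemma mem_universal_vertices_iff:
  assumes "S \<subseteq> V"
  shows "v \<in> universal_vertices E S \<longleftrightarrow> v \<in> S \<and> S \<inter> neighbours V (complement_edges V E) v = {}"
proof (cases "v \<in> S")
  case True
  then have "v \<in> V"
    using assms by blast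
  with assms True show ?thesis
    unfolding neighbours_complement_edges[OF \<open>v \<in> V\<close>]
    by (auto simp: universal_vertices_def neighbours_def)
qed (simp add: universal_vertices_def)

definition uncovered_edges :: "'a set set \<Rightarrow> 'a set set \<Rightarrow> 'a set set" where
  "uncovered_edges E \<C> = {e \<in> E. \<forall>C\<in>\<C>. \<not> e \<subseteq> C}"

lemma scc_le_cliques:
  assumes G: "simple_graph V E" and \<C>: "\<And>C. C \<in> \<C> \<Longrightarrow> clique V E C"
  shows "scc V E \<le> (\<Sum>C\<in>\<C>. card C) + 2 * card (uncovered_edges E \<C>)"
proof -
  let ?R = "uncovered_edges E \<C>"
  have "\<C> \<subseteq> Pow V"
    using \<C> by (auto simp: clique_def)
  then have fin: "finite \<C>" "finite ?R"
    using G simple_graph_imp_finite_edges[OF G]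
    by (auto simp: simple_graph_def uncovered_edges_def intro: finite_subset)
  have "clique_covering V E (\<C> \<union> ?R)"
    unfolding clique_covering_def
  proof (intro conjI ballI)
    show "clique V E C" if "C \<in> \<C> \<union> ?R" for C
      using that \<C> clique_covering_edges[OF G]
      by (auto simp: clique_covering_def uncovered_edges_def)
    show "\<exists>C\<in>\<C> \<union> ?R. e \<subseteq> C" if "e \<in> E" for e
      using that by (cases "e \<in> ?R") (auto simp: uncovered_edges_def)
  qed
  then have "scc V E \<le> (\<Sum>C\<in>\<C> \<union> ?R. card C)"
    by (rule scc_le[OF G])
  also have "\<dots> \<le> (\<Sum>C\<in>\<C>. card C) + (\<Sum>e\<in>?R. card e)"
    using sum.union_inter[OF fin, of card] by simp
  also have "(\<Sum>e\<in>?R. card e) = (\<Sum>e\<in>?R. 2)"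
    using G by (intro sum.cong) (auto simp: uncovered_edges_def simple_graph_def all_pairs_eq)
  finally show ?thesis
    by simp
qed

lemma scc_le_indexed_cliques:
  assumes "simple_graph V E" "finite I" "\<And>i. i \<in> I \<Longrightarrow> clique V E (f i)"
  shows "real (scc V E) \<le> (\<Sum>i\<in>I. real (card (f i))) + 2 * real (card (uncovered_edges E (f ` I)))"
proof -
  have "scc V E \<le> (\<Sum>C\<in>f ` I. card C) + 2 * card (uncovered_edges E (f ` I))"
    using assms(3) by (intro scc_le_cliques[OF assms(1)]) auto
  also have "(\<Sum>C\<in>f ` I. card C) \<le> (\<Sum>i\<in>I. card (f i))"
    using sum_image_le[OF assms(2), of card f] by simp
  finally show ?thesis
    by (simp flip: of_nat_sum of_nat_add)
qed

lemma expectation_card_filter: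
  assumes "finite A"
  shows "measure_pmf.expectation M (\<lambda>x. real (card {a \<in> A. P a x}))
    = (\<Sum>a\<in>A. measure_pmf.prob M {x. P a x})"
proof -
  have "real (card {a \<in> A. P a x}) = (\<Sum>a\<in>A. indicator {x. P a x} x)" for x
    using assms by (simp add: indicator_def sum.If_cases Int_def)
  then have "measure_pmf.expectation M (\<lambda>x. real (card {a \<in> A. P a x}))
      = measure_pmf.expectation M (\<lambda>x. \<Sum>a\<in>A. indicator {x. P a x} x)"
    by simp
  also have "\<dots> = (\<Sum>a\<in>A. measure_pmf.expectation M (indicator {x. P a x}))"
    by (intro Bochner_Integration.integral_sum integrable_real_indicator)
      (simp_all add: less_top[symmetric])
  finally show ?thesis
    by simp
qed

lemma expectation_Pi_pmf_component:
  fixes g :: "'b \<Rightarrow> 'c :: {banach, second_countable_topology}"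
  assumes "finite A" "i \<in> A"
  shows "measure_pmf.expectation (Pi_pmf A dflt M) (\<lambda>f. g (f i)) = measure_pmf.expectation (M i) g"
proof -
  have "map_pmf (\<lambda>f. f i) (Pi_pmf A dflt M) = M i"
    using assms by (simp add: Pi_pmf_component)
  then show ?thesis
    by (metis integral_map_pmf)
qed

lemma prob_Pi_pmf_none:
  assumes "finite A"
  shows "measure_pmf.prob (Pi_pmf A dflt M) {f. \<forall>i\<in>A. \<not> P i (f i)}
    = (\<Prod>i\<in>A. 1 - measure_pmf.prob (M i) {x. P i x})"
proof -
  have "{f. \<forall>i\<in>A. \<not> P i (f i)} = Pi A (\<lambda>i. - {x. P i x})"
    by auto
  then show ?thesis
    using assms measure_pmf.prob_compl[of "{x. P i x}" "M i" for i]
    by (simp add: measure_Pi_pmf_Pi Compl_eq_Diff_UNIV)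
qed

definition random_subset_pmf :: "real \<Rightarrow> 'a set \<Rightarrow> 'a set pmf" where
  "random_subset_pmf p V = map_pmf (\<lambda>b. {v \<in> V. b v}) (Pi_pmf V False (\<lambda>_. bernoulli_pmf p))"

lemma set_random_subset_pmf: "set_pmf (random_subset_pmf p V) \<subseteq> Pow V"
  by (auto simp: random_subset_pmf_def)

lemma prob_random_subset_pmf_cylinder:
  assumes "finite V" "A \<subseteq> V" "B \<subseteq> V" "A \<inter> B = {}" "0 \<le> p" "p \<le> 1"
  shows "measure_pmf.prob (random_subset_pmf p V) {S. A \<subseteq> S \<and> S \<inter> B = {}}
    = p ^ card A * (1 - p) ^ card B"
proof -
  define F where "F v = (if v \<in> A then {True} else if v \<in> B then {False} else UNIV)" for v
  have "(\<lambda>b. {v \<in> V. b v}) -` {S. A \<subseteq> S \<and> S \<inter> B = {}} = Pi V F"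
    using assms(2-4) by (fastforce simp: F_def Pi_def split: if_splits)
  then have "measure_pmf.prob (random_subset_pmf p V) {S. A \<subseteq> S \<and> S \<inter> B = {}}
      = (\<Prod>v\<in>V. measure_pmf.prob (bernoulli_pmf p) (F v))"
    using assms(1) by (simp add: random_subset_pmf_def measure_Pi_pmf_Pi)
  also have "\<dots> = (\<Prod>v\<in>V. (if v \<in> A then p else 1) * (if v \<in> B then 1 - p else 1))"
    using assms(4-6) by (intro prod.cong) (auto simp: F_def measure_pmf_single)
  also have "\<dots> = p ^ card A * (1 - p) ^ card B"
    using assms(1-3) by (simp add: prod.distrib prod.If_cases Int_absorb1)
  finally show ?thesis .
qed

lemma expectation_card_random_subset_pmf:
  assumes "finite V" "0 \<le> p" "p \<le> 1"
  shows "measure_pmf.expectation (random_subset_pmf p V) (\<lambda>S. real (card S)) = p * real (card V)"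
proof -
  have "measure_pmf.expectation (random_subset_pmf p V) (\<lambda>S. real (card S))
      = measure_pmf.expectation (random_subset_pmf p V) (\<lambda>S. real (card {v \<in> V. v \<in> S}))"
  proof (rule integral_cong_AE)
    show "AE S in random_subset_pmf p V. real (card S) = real (card {v \<in> V. v \<in> S})"
      using set_random_subset_pmf[of p V]
      by (auto simp: AE_measure_pmf_iff intro!: arg_cong[of _ _ card])
  qed simp_all
  also have "\<dots> = (\<Sum>v\<in>V. measure_pmf.prob (random_subset_pmf p V) {S. v \<in> S})"
    by (rule expectation_card_filter[OF assms(1)])
  also have "\<dots> = (\<Sum>v\<in>V. p)"
    using prob_random_subset_pmf_cylinder[OF assms(1) _ _ _ assms(2,3), of "{v}" "{}" for v]
    by (intro sum.cong) simp_all
  finally show ?thesis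
    by simp
qed

definition random_clique_pmf :: "real \<Rightarrow> 'a set \<Rightarrow> 'a set set \<Rightarrow> 'a set pmf" where
  "random_clique_pmf p V E = map_pmf (universal_vertices E) (random_subset_pmf p V)"

lemma clique_random_clique_pmf: "C \<in> set_pmf (random_clique_pmf p V E) \<Longrightarrow> clique V E C"
  using set_random_subset_pmf[of p V]
  by (auto simp: random_clique_pmf_def intro: clique_universal_vertices)

lemma expectation_card_random_clique_pmf_le:
  assumes "finite V" "0 \<le> p" "p \<le> 1"
  shows "measure_pmf.expectation (random_clique_pmf p V E) (\<lambda>C. real (card C)) \<le> p * real (card V)"
proof -
  let ?M = "random_subset_pmf p V"
  have fin: "finite (set_pmf ?M)"
    using assms(1) by (simp add: finite_subset[OF set_random_subset_pmf])
  have "card (universal_vertices E S) \<le> card S" if "S \<in> set_pmf ?M" for S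
    using that set_random_subset_pmf[of p V] assms(1)
    by (intro card_mono) (auto simp: universal_vertices_def intro: finite_subset)
  then have "measure_pmf.expectation ?M (\<lambda>S. real (card (universal_vertices E S)))
      \<le> measure_pmf.expectation ?M (\<lambda>S. real (card S))"
    by (intro integral_mono_AE integrable_measure_pmf_finite[OF fin]) (simp add: AE_measure_pmf_iff)
  then show ?thesis
    by (simp add: random_clique_pmf_def expectation_card_random_subset_pmf[OF assms])
qed

lemma prob_edge_subset_random_clique_pmf_ge:
  assumes G: "simple_graph V E" and "e \<in> E" and p: "0 \<le> p" "p \<le> 1"
    and k: "max_degree V (complement_edges V E) \<le> k"
  shows "p\<^sup>2 * (1 - p) ^ (2 * k) \<le> measure_pmf.prob (random_clique_pmf p V E) {C. e \<subseteq> C}"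
proof -
  have fin: "finite V"
    using G by (simp add: simple_graph_def)
  have "e \<subseteq> V" "card e = 2"
    using G \<open>e \<in> E\<close> by (auto simp: simple_graph_def all_pairs_eq)
  then obtain u v where e: "e = {u, v}" "u \<in> V" "v \<in> V"
    by (auto simp: card_2_iff)
  define N where "N = neighbours V (complement_edges V E)"
  define B where "B = N u \<union> N v"
  have card_N: "card (N w) \<le> k" if "w \<in> V" for w
    using vertex_degree_le_max_degree[OF fin that, of "complement_edges V E"] k
    by (simp add: N_def vertex_degree_eq_card_neighbours)
  have card_B: "card B \<le> 2 * k"
    using card_Un_le[of "N u" "N v"] card_N[OF e(2)] card_N[OF e(3)] unfolding B_def by linarith
  have e_subset: "e \<subseteq> universal_vertices E S \<longleftrightarrow> e \<subseteq> S \<and> S \<inter> B = {}" if "S \<subseteq> V" for S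
    using e(1) by (auto simp: mem_universal_vertices_iff[OF that] B_def N_def)
  have "e \<subseteq> universal_vertices E e"
    using \<open>e \<in> E\<close> e(1) by (auto simp: universal_vertices_def insert_commute)
  then have B: "B \<subseteq> V" "e \<inter> B = {}"
    using e_subset[OF \<open>e \<subseteq> V\<close>] by (auto simp: B_def N_def neighbours_def)
  have "p\<^sup>2 * (1 - p) ^ (2 * k) \<le> p ^ card e * (1 - p) ^ card B"
    using card_B p \<open>card e = 2\<close> by (simp add: mult_left_mono power_decreasing)
  also have "\<dots> = measure_pmf.prob (random_subset_pmf p V) {S. e \<subseteq> S \<and> S \<inter> B = {}}"
    using prob_random_subset_pmf_cylinder[OF fin \<open>e \<subseteq> V\<close> B p] by simp
  also have "\<dots> = measure_pmf.prob (random_subset_pmf p V) {S. e \<subseteq> universal_vertices E S}"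
    using e_subset set_random_subset_pmf[of p V]
    by (intro measure_pmf.finite_measure_eq_AE) (auto simp: AE_measure_pmf_iff)
  finally show ?thesis
    by (simp add: random_clique_pmf_def vimage_def)
qed

lemma expectation_card_uncovered_edges:
  assumes "finite E" "finite I"
  shows "measure_pmf.expectation (Pi_pmf I dflt (\<lambda>_. M))
      (\<lambda>f. real (card (uncovered_edges E (f ` I))))
    = (\<Sum>e\<in>E. (1 - measure_pmf.prob M {C. e \<subseteq> C}) ^ card I)"
  unfolding uncovered_edges_def ball_simps
  by (simp only: expectation_card_filter[OF assms(1)] prod_constant
      prob_Pi_pmf_none[OF assms(2), where P = "\<lambda>_. (\<subseteq>) e" for e])

lemma scc_le_expectation:
  assumes G: "simple_graph V E" and M: "\<And>C. C \<in> set_pmf M \<Longrightarrow> clique V E C"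
    and q: "\<And>e. e \<in> E \<Longrightarrow> q \<le> measure_pmf.prob M {C. e \<subseteq> C}"
  shows "real (scc V E) \<le> real t * measure_pmf.expectation M (\<lambda>C. real (card C))
    + 2 * real (card E) * (1 - q) ^ t"
proof -
  define P where "P = Pi_pmf {..<t} {} (\<lambda>_. M)"
  let ?size = "\<lambda>f. \<Sum>i<t. real (card (f i))"
  let ?uncovered = "\<lambda>f. real (card (uncovered_edges E (f ` {..<t})))"
  have "set_pmf M \<subseteq> Pow V"
    using M by (auto simp: clique_def)
  then have "finite (set_pmf M)"
    using G by (auto simp: simple_graph_def intro: finite_subset)
  then have "finite (set_pmf P)"
    by (simp add: P_def set_Pi_pmf finite_PiE_dflt)
  then have int: "integrable P g" for g :: "(nat \<Rightarrow> 'a set) \<Rightarrow> real"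
    by (rule integrable_measure_pmf_finite)
  have "real (scc V E) \<le> ?size f + 2 * ?uncovered f" if "f \<in> set_pmf P" for f
    using that M
    by (intro scc_le_indexed_cliques[OF G]) (auto simp: P_def set_Pi_pmf PiE_dflt_def)
  then have "real (scc V E) \<le> measure_pmf.expectation P (\<lambda>f. ?size f + 2 * ?uncovered f)"
    by (intro measure_pmf.integral_ge_const int) (simp add: AE_measure_pmf_iff)
  also have "\<dots> = (\<Sum>i<t. measure_pmf.expectation P (\<lambda>f. real (card (f i))))
      + 2 * measure_pmf.expectation P ?uncovered"
    by (simp add: int)
  also have "(\<Sum>i<t. measure_pmf.expectation P (\<lambda>f. real (card (f i))))
      = (\<Sum>i<t. measure_pmf.expectation M (\<lambda>C. real (card C)))"
    unfolding P_def
    by (intro sum.cong refl expectation_Pi_pmf_component[where g = "\<lambda>C. real (card C)"]) simp_all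
  also have "measure_pmf.expectation P ?uncovered
      = (\<Sum>e\<in>E. (1 - measure_pmf.prob M {C. e \<subseteq> C}) ^ t)"
    by (simp add: P_def expectation_card_uncovered_edges simple_graph_imp_finite_edges[OF G])
  also have "\<dots> \<le> (\<Sum>e\<in>E. (1 - q) ^ t)"
    using q by (intro sum_mono power_mono) auto
  finally show ?thesis
    by simp
qed

lemma scc_le_random_cliques:
  assumes G: "simple_graph V E" and p: "0 \<le> p" "p \<le> 1"
    and k: "max_degree V (complement_edges V E) \<le> k"
  shows "real (scc V E) \<le> real t * (p * real (card V))
    + real (card V) * (real (card V) - 1) * (1 - p\<^sup>2 * (1 - p) ^ (2 * k)) ^ t"
proof -
  let ?q = "p\<^sup>2 * (1 - p) ^ (2 * k)"
  have "real (2 * card E) \<le> real (card V * (card V - 1))"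
    using card_edges_le[OF G] unfolding choose_two of_nat_le_iff by linarith
  then have card_E: "2 * real (card E) \<le> real (card V) * (real (card V) - 1)"
    by (cases "card V") (simp_all add: algebra_simps)
  have q: "?q \<le> 1"
    using p by (intro mult_le_one power_le_one) auto
  have "real (scc V E)
      \<le> real t * measure_pmf.expectation (random_clique_pmf p V E) (\<lambda>C. real (card C))
      + 2 * real (card E) * (1 - ?q) ^ t"
    using G p k
    by (intro scc_le_expectation clique_random_clique_pmf prob_edge_subset_random_clique_pmf_ge)
  also have "\<dots> \<le> real t * (p * real (card V)) + real (card V) * (real (card V) - 1) * (1 - ?q) ^ t"
    using G p q card_E
    by (intro add_mono mult_left_mono mult_right_mono expectation_card_random_clique_pmf_le)
       (auto simp: simple_graph_def)
  finally show ?thesis .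
qed

lemma one_minus_inverse_power_ge:
  assumes "0 < d"
  shows "exp (-1) \<le> (1 - 1 / real d) ^ (d - 1)"
proof -
  obtain k where d: "d = Suc k"
    using assms gr0_implies_Suc by blast
  show ?thesis
  proof (cases "k = 0")
    case False
    define x where "x = 1 / real k"
    have x: "0 < x" "real k * x = 1" "1 - 1 / real d = inverse (1 + x)"
      using False by (simp_all add: x_def d field_simps)
    have "exp (-1) = exp (- x) ^ k"
      using x(2) by (simp flip: exp_of_nat_mult)
    also have "\<dots> \<le> inverse (1 + x) ^ k"
      using x(1) by (intro power_mono) (simp_all add: exp_minus le_imp_inverse_le)
    finally show ?thesis
      unfolding x(3) by (simp add: d)
  qed (simp add: d)
qed

lemma square_mult_one_minus_power_ge:
  assumes "0 < d"
  shows "inverse ((exp 1 * real d)\<^sup>2) \<le> (1 / real d)\<^sup>2 * (1 - 1 / real d) ^ (2 * (d - 1))"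
proof -
  have "inverse ((exp 1 * real d)\<^sup>2) = (1 / real d * exp (-1))\<^sup>2"
    by (simp add: exp_minus divide_inverse power_mult_distrib mult.commute flip: power_inverse)
  also have "\<dots> \<le> (1 / real d * (1 - 1 / real d) ^ (d - 1))\<^sup>2"
    by (intro power_mono mult_left_mono one_minus_inverse_power_ge assms) simp_all
  also have "\<dots> = (1 / real d)\<^sup>2 * (1 - 1 / real d) ^ (2 * (d - 1))"
    by (simp only: power_mult_distrib power_mult mult.commute[of 2])
  finally show ?thesis .
qed

lemma one_minus_power_le_exp:
  fixes q :: real
  assumes "q \<le> 1"
  shows "(1 - q) ^ t \<le> exp (- (q * real t))"
proof -
  have "(1 - q) ^ t \<le> exp (- q) ^ t"
    using assms by (intro power_mono exp_minus_ge) simp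
  then show ?thesis
    by (simp add: mult.commute flip: exp_of_nat_mult)
qed

lemma scc_le_exp:
  assumes G: "simple_graph V E" and d: "max_degree V (complement_edges V E) < d" and L: "0 \<le> L"
  shows "real (scc V E) \<le> (exp 1)\<^sup>2 * real (card V) * real d * L + real (card V) / real d
    + real (card V) * (real (card V) - 1) * exp (- L)"
proof -
  define p where "p = 1 / real d"
  define q where "q = p\<^sup>2 * (1 - p) ^ (2 * (d - 1))"
  define t where "t = nat \<lceil>(exp 1 * real d)\<^sup>2 * L\<rceil>"
  have p: "0 \<le> p" "p \<le> 1" and d_pos: "0 < real d"
    using d by (simp_all add: p_def)
  have t: "(exp 1 * real d)\<^sup>2 * L \<le> real t" "real t \<le> (exp 1 * real d)\<^sup>2 * L + 1"
    using L by (simp_all add: t_def of_nat_ceiling)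
  have q: "q \<le> 1" "inverse ((exp 1 * real d)\<^sup>2) \<le> q"
    using p square_mult_one_minus_power_ge[of d] d
    by (auto simp: q_def p_def intro!: mult_le_one power_le_one)
  have "L = inverse ((exp 1 * real d)\<^sup>2) * ((exp 1 * real d)\<^sup>2 * L)"
    using d_pos by simp
  also have "\<dots> \<le> q * real t"
    using q(2) t(1) L p by (intro mult_mono) (auto simp: q_def)
  finally have power_le: "(1 - q) ^ t \<le> exp (- L)"
    using one_minus_power_le_exp[OF q(1), of t] by (simp add: order_trans)
  have "real (scc V E) \<le> real t * (p * real (card V))
      + real (card V) * (real (card V) - 1) * (1 - q) ^ t"
    using d unfolding q_def by (intro scc_le_random_cliques[OF G p]) simp
  also have "\<dots> \<le> ((exp 1 * real d)\<^sup>2 * L + 1) * (p * real (card V))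
      + real (card V) * (real (card V) - 1) * exp (- L)"
  proof (intro add_mono mult_right_mono mult_left_mono t(2) power_le)
    show "0 \<le> real (card V) * (real (card V) - 1)"
      by (cases "card V") simp_all
  qed (use p in simp)
  also have "((exp 1 * real d)\<^sup>2 * L + 1) * (p * real (card V))
      = (exp 1)\<^sup>2 * real (card V) * real d * L + real (card V) / real d"
    using d_pos by (simp add: p_def field_simps power2_eq_square)
  finally show ?thesis .
qed

theorem theorem3:
  fixes V :: "'a set" and E :: "'a set set" and n d :: nat
  assumes "n \<ge> 2" and "d \<ge> 2"
    and "simple_graph V E" and "card V = n"
    and "\<not> (\<exists>v. isolated V E v)"
    and "max_degree V (complement_edges V E) = d - 1"
  shows "real (scc V E) \<le>
    ((exp 1)\<^sup>2 + 1) * real n * real d * of_int \<lceil>ln ((real n - 1) / (real d - 1))\<rceil>"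
proof -
  define L where "L = ln ((real n - 1) / (real d - 1))"
  have "d < n"
    using max_degree_complement_edges_less[of V E] assms by fastforce
  then have L: "0 < L" "(real n - 1) * exp (- L) = real d - 1"
    using assms(2) by (simp_all add: L_def exp_minus)
  have "real (scc V E) \<le> (exp 1)\<^sup>2 * real n * real d * L + real n / real d
      + real n * ((real n - 1) * exp (- L))"
    using scc_le_exp[OF assms(3), of d L] assms L(1) by (simp add: mult.assoc)
  also have "\<dots> = (exp 1)\<^sup>2 * real n * real d * L + real n * (1 / real d + real d - 1)"
    unfolding L(2) by (simp add: algebra_simps)
  also have "\<dots> \<le> (exp 1)\<^sup>2 * real n * real d * \<lceil>L\<rceil> + real n * (real d * \<lceil>L\<rceil>)"
  proof (intro add_mono mult_left_mono)
    have "1 / real d \<le> 1" "1 \<le> real_of_int \<lceil>L\<rceil>"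
      using assms(2) L(1) by simp_all
    then show "1 / real d + real d - 1 \<le> real d * \<lceil>L\<rceil>"
      using mult_left_mono[of 1 "real_of_int \<lceil>L\<rceil>" "real d"] by simp
  qed simp_all
  also have "\<dots> = ((exp 1)\<^sup>2 + 1) * real n * real d * \<lceil>L\<rceil>"
    by (simp add: algebra_simps)
  finally show ?thesis
    unfolding L_def .
qed

end
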